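(* For all non-negative integers $n,m,p,q$ and all complex numbers $z,z',w,w',\gamma,\gamma'$, $$H_{n,m}^{(p,q)}(z+z',w+w'|\gamma+\gamma')=\sum_{k=0}^{n}\sum_{j=0}^{m}\binom{n}{k}\binom{m}{j}H_{k,j}^{(p,q)}(z,w|\gamma)\,H_{n-k,m-j}^{(p,q)}(z',w'|\gamma').$$
   Context: For non-negative integers $n,m,p,q$ and complex $z,w,\gamma$, $$H_{n,m}^{(p,q)}(z,w|\gamma)= n!\,m!\sum_{k=0}^{\lfloor n/p\rfloor\wedge\lfloor m/q\rfloor}\frac{\gamma^k}{k!}\frac{z^{n-pk}}{(n-pk)!}\frac{w^{m-qk}}{(m-qk)!},$$ where $a\wedge b=\min\{a,b\}$ and $\lfloor j/0\rfloor=+\infty$ by convention (so for $p=q=0$ the sum is the infinite series $e^{\gamma}z^nw^m$); $0^0=1$. *)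

theory Defs
  imports "HOL-Analysis.Analysis" "HOL-Library.Extended_Nat"
begin

(* The floor of a / b, with the convention that it is infinity for b = 0;
   the built-in division on nat would give a div 0 = 0 instead. *)
definition floor_quot :: "nat \<Rightarrow> nat \<Rightarrow> enat" where
  "floor_quot a b = (if b = 0 then \<infinity> else enat (a div b))"

(* The index set is finite (and the infinite-sum operator is then the ordinary finite sum)
   unless p = q = 0, when it is all of nat and the sum is a convergent exponential series.
   On the index set p * k \<le> n and q * k \<le> m, so the subtractions are not truncated. *)
definition H :: "nat \<Rightarrow> nat \<Rightarrow> nat \<Rightarrow> nat \<Rightarrow> complex \<Rightarrow> complex \<Rightarrow> complex \<Rightarrow> complex" where
  "H p q n m z w \<gamma> = fact n * fact m *
     (\<Sum>\<^sub>\<infinity>k\<in>{k. enat k \<le> min (floor_quot n p) (floor_quot m q)}.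
        \<gamma> ^ k / fact k * (z ^ (n - p * k) / fact (n - p * k)) * (w ^ (m - q * k) / fact (m - q * k)))"

lemma le_floor_quot_iff: "enat k \<le> floor_quot a b \<longleftrightarrow> b * k \<le> a"
  by (auto simp: floor_quot_def less_eq_div_iff_mult_less_eq mult.commute)

lemma H_0_0: "H 0 0 n m z w \<gamma> = exp \<gamma> * z ^ n * w ^ m"
proof -
  have "((\<lambda>k. \<gamma> ^ k / fact k) has_sum exp \<gamma>) UNIV"
    using summable_norm_exp[of \<gamma>] exp_converges[of \<gamma>]
    by (intro norm_summable_imp_has_sum) (simp_all add: scaleR_conv_of_real field_simps)
  then have "((\<lambda>k. \<gamma> ^ k / fact k * (z ^ n / fact n) * (w ^ m / fact m)) has_sum
      exp \<gamma> * (z ^ n / fact n) * (w ^ m / fact m)) UNIV"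
    by (intro has_sum_cmult_left)
  from infsumI[OF this] show ?thesis
    by (simp add: H_def floor_quot_def)
qed

end

(* Dividing by n! m! turns the claim into a Cauchy product of divided powers x^n / n!, which satisfy
   the binomial identity without coefficients. Expanding both sides in the exponents of
   z, w, \<gamma>, \<gamma>' gives the same finite sum; for p = q = 0, where the sum is infinite, H is
   exp \<gamma> z^n w^m and the binomial theorem applies directly. *)
theory Submission
  imports Defs
begin

text \<open>This is the binomial theorem over \<open>n!\<close>: the quotient of
  \<open>n choose i\<close> by \<open>n!\<close> is \<open>1 / (i! (n - i)!)\<close>, which splits
  between the two powers.\<close>

lemma divided_power_add:
  fixes x y :: "'a::field_char_0"
  shows "(x + y) ^ n / fact n = (\<Sum>i\<le>n. (x ^ i / fact i) * (y ^ (n - i) / fact (n - i)))"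
  unfolding binomial_ring sum_divide_distrib
  by (intro sum.cong refl) (simp add: binomial_fact field_simps)

text \<open>The multiplicative form of the bounds treats \<open>p = 0\<close> or
  \<open>q = 0\<close> uniformly, with no division and no extended naturals.\<close>

definition H_index :: "nat \<Rightarrow> nat \<Rightarrow> nat \<Rightarrow> nat \<Rightarrow> nat set" where
  "H_index p q n m = {k. p * k \<le> n \<and> q * k \<le> m}"

lemma finite_H_index:
  assumes "p \<noteq> 0 \<or> q \<noteq> 0"
  shows "finite (H_index p q n m)"
proof (rule finite_subset)
  have "k \<le> max n m" if "p * k \<le> n" "q * k \<le> m" for k
    \<comment> \<open>A nonzero \<open>p\<close> gives \<open>k \<le> p * k \<le> n\<close>; a
      nonzero \<open>q\<close> gives \<open>k \<le> q * k \<le> m\<close>.\<close>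
    using assms le_trans[OF _ that(1), of k] le_trans[OF _ that(2), of k]
    by (auto simp: le_max_iff_disj)
  then show "H_index p q n m \<subseteq> {..max n m}"
    by (auto simp: H_index_def)
qed simp

lemma H_eq_finite_sum:
  assumes "p \<noteq> 0 \<or> q \<noteq> 0"
  shows "H p q n m z w \<gamma> = fact n * fact m *
    (\<Sum>k\<in>H_index p q n m.
      \<gamma> ^ k / fact k * (z ^ (n - p * k) / fact (n - p * k)) * (w ^ (m - q * k) / fact (m - q * k)))"
proof -
  have "{k. enat k \<le> min (floor_quot n p) (floor_quot m q)} = H_index p q n m"
    by (auto simp: H_index_def le_floor_quot_iff)
  then show ?thesis
    using finite_H_index[OF assms] by (simp add: H_def)
qed

text \<open>Both sides run over the exponent tuples \<open>(r, s, a, a', b, b')\<close> with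
  \<open>p * (r + s) + a + a' = n\<close> and \<open>q * (r + s) + b + b' = m\<close>. The left
  groups them by \<open>t = r + s\<close>, the right by \<open>k = a + p * r\<close> and
  \<open>j = b + q * r\<close>, the degrees taken up by the unprimed factor.\<close>

lemma sum_H_index_reindex:
  fixes f :: "nat \<Rightarrow> nat \<Rightarrow> nat \<Rightarrow> nat \<Rightarrow> nat \<Rightarrow> nat \<Rightarrow> 'a::comm_monoid_add"
  assumes "p \<noteq> 0 \<or> q \<noteq> 0"
  shows "(\<Sum>t\<in>H_index p q n m. \<Sum>r\<le>t. \<Sum>a\<le>n - p * t. \<Sum>b\<le>m - q * t.
            f r (t - r) a (n - p * t - a) b (m - q * t - b)) =
         (\<Sum>k\<le>n. \<Sum>j\<le>m. \<Sum>r\<in>H_index p q k j. \<Sum>s\<in>H_index p q (n - k) (m - j).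
            f r s (k - p * r) (n - k - p * s) (j - q * r) (m - j - q * s))"
proof -
  \<comment> \<open>The local \<open>p\<close>, \<open>n\<close>, \<open>a\<close> are generic, so
    that the fact serves the pair \<open>p\<close>, \<open>n\<close> as well as \<open>q\<close>,
    \<open>m\<close>. It also keeps every subtraction on \<open>nat\<close> from being
    truncated.\<close>
  have forward:
    "a + p * r \<le> n \<and> p * (t - r) \<le> n - (a + p * r) \<and>
     a + p * r + p * (t - r) = p * t + a"
    if "p * t \<le> n" "r \<le> t" "a \<le> n - p * t" for p n t r a :: nat
  proof -
    have "p * t = p * r + p * (t - r)"
      using that(2) by (simp flip: distrib_left)
    then show ?thesis
      using that by linarith
  qed
  have backward: "p * (r + s) \<le> n \<and> k - p * r \<le> n - p * (r + s)"
    if "k \<le> n" "p * r \<le> k" "p * s \<le> n - k" for p n k r s :: nat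
    using that unfolding distrib_left by linarith
  let ?L = "SIGMA t:H_index p q n m. SIGMA r:{..t}. {..n - p * t} \<times> {..m - q * t}"
  let ?R = "SIGMA k:{..n}. SIGMA j:{..m}. H_index p q k j \<times> H_index p q (n - k) (m - j)"
  have "(\<Sum>(t, r, a, b)\<in>?L. f r (t - r) a (n - p * t - a) b (m - q * t - b)) =
        (\<Sum>(k, j, r, s)\<in>?R. f r s (k - p * r) (n - k - p * s) (j - q * r) (m - j - q * s))"
    \<comment> \<open>\<open>j\<close> passes from the left tuples to the right ones, and
      \<open>i\<close> inverts it by \<open>t = r + s\<close>, \<open>a = k - p * r\<close>,
      \<open>b = j - q * r\<close>.\<close>
    by (rule sum.reindex_bij_witness[where
          i = "\<lambda>(k, j, r, s). (r + s, r, k - p * r, j - q * r)" and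
          j = "\<lambda>(t, r, a, b). (a + p * r, b + q * r, r, t - r)"])
       (clarsimp simp: H_index_def forward backward)+
  then show ?thesis
    by (simp add: sum.Sigma finite_H_index[OF assms])
qed

lemma H_add_nonzero:
  assumes "p \<noteq> 0 \<or> q \<noteq> 0"
  shows "H p q n m (z + z') (w + w') (\<gamma> + \<gamma>') =
    (\<Sum>k\<le>n. \<Sum>j\<le>m. of_nat (n choose k) * of_nat (m choose j) *
       H p q k j z w \<gamma> * H p q (n - k) (m - j) z' w' \<gamma>')"
proof -
  define d :: "complex \<Rightarrow> nat \<Rightarrow> complex" where "d x i = x ^ i / fact i" for x i
  \<comment> \<open>\<open>h\<close> is \<open>H\<close> without the factor \<open>n! m!\<close>; in
    this normalization the identity has no binomial coefficients.\<close>
  define h where "h n m z w \<gamma> = (\<Sum>k\<in>H_index p q n m. d \<gamma> k * d z (n - p * k) * d w (m - q * k))"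
    for n m z w \<gamma>
  have H_h: "H p q n m z w \<gamma> = fact n * fact m * h n m z w \<gamma>" for n m z w \<gamma>
    unfolding H_eq_finite_sum[OF assms] h_def d_def ..
  have d_add: "d (x + y) i = (\<Sum>a\<le>i. d x a * d y (i - a))" for x y i
    unfolding d_def by (rule divided_power_add)
  have "h n m (z + z') (w + w') (\<gamma> + \<gamma>') =
      (\<Sum>t\<in>H_index p q n m. \<Sum>r\<le>t. \<Sum>a\<le>n - p * t. \<Sum>b\<le>m - q * t.
         d \<gamma> r * d \<gamma>' (t - r) * (d z a * d z' (n - p * t - a)) * (d w b * d w' (m - q * t - b)))"
    unfolding h_def d_add by (simp only: flip: sum_distrib_left sum_distrib_right)
  also have "\<dots> = (\<Sum>k\<le>n. \<Sum>j\<le>m. \<Sum>r\<in>H_index p q k j. \<Sum>s\<in>H_index p q (n - k) (m - j).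
         d \<gamma> r * d \<gamma>' s * (d z (k - p * r) * d z' (n - k - p * s)) *
           (d w (j - q * r) * d w' (m - j - q * s)))"
    by (rule sum_H_index_reindex[OF assms])
  also have "\<dots> = (\<Sum>k\<le>n. \<Sum>j\<le>m. h k j z w \<gamma> * h (n - k) (m - j) z' w' \<gamma>')"
    unfolding h_def sum_product by (intro sum.cong refl) (simp only: mult_ac)
  finally have "H p q n m (z + z') (w + w') (\<gamma> + \<gamma>') =
      (\<Sum>k\<le>n. \<Sum>j\<le>m. fact n * fact m * (h k j z w \<gamma> * h (n - k) (m - j) z' w' \<gamma>'))"
    by (simp add: H_h sum_distrib_left)
  also have "\<dots> = (\<Sum>k\<le>n. \<Sum>j\<le>m. of_nat (n choose k) * of_nat (m choose j) *
       H p q k j z w \<gamma> * H p q (n - k) (m - j) z' w' \<gamma>')"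
    \<comment> \<open>The binomial coefficients return from
      \<open>n! = (n choose k) * k! * (n - k)!\<close> and its analogue for \<open>m\<close>,
      \<open>j\<close>.\<close>
    by (intro sum.cong refl) (simp add: H_h binomial_fact)
  finally show ?thesis .
qed

lemma H_add_0_0:
  "H 0 0 n m (z + z') (w + w') (\<gamma> + \<gamma>') =
    (\<Sum>k\<le>n. \<Sum>j\<le>m. of_nat (n choose k) * of_nat (m choose j) *
       H 0 0 k j z w \<gamma> * H 0 0 (n - k) (m - j) z' w' \<gamma>')"
proof -
  \<comment> \<open>With \<open>p = q = 0\<close> the three variables decouple, so the two binomial
    sums are independent and their product is the double sum.\<close>
  have "H 0 0 n m (z + z') (w + w') (\<gamma> + \<gamma>') = exp \<gamma> * exp \<gamma>' *
      ((\<Sum>k\<le>n. of_nat (n choose k) * z ^ k * z' ^ (n - k)) *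
       (\<Sum>j\<le>m. of_nat (m choose j) * w ^ j * w' ^ (m - j)))"
    by (simp only: H_0_0 exp_add binomial_ring mult.assoc)
  also have "\<dots> = (\<Sum>k\<le>n. \<Sum>j\<le>m. of_nat (n choose k) * of_nat (m choose j) *
      H 0 0 k j z w \<gamma> * H 0 0 (n - k) (m - j) z' w' \<gamma>')"
    unfolding H_0_0 sum_product by (simp only: sum_distrib_left mult_ac)
  finally show ?thesis .
qed

theorem proposition4p1:
  fixes n m p q :: nat and z z' w w' \<gamma> \<gamma>' :: complex
  shows "H p q n m (z + z') (w + w') (\<gamma> + \<gamma>') =
    (\<Sum>k=0..n. \<Sum>j=0..m. of_nat (n choose k) * of_nat (m choose j) *
       H p q k j z w \<gamma> * H p q (n - k) (m - j) z' w' \<gamma>')"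
proof (cases "p = 0 \<and> q = 0")
  case True
  then show ?thesis
    unfolding atLeast0AtMost by (simp only: H_add_0_0)
next
  case False
  then show ?thesis
    unfolding atLeast0AtMost by (intro H_add_nonzero) simp
qed

end
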